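(* Let $\mathcal{G}=(\mathcal{V},\mathcal{E},A)$ be a weighted graph with $n$ nodes that is either a strongly connected digraph or a connected undirected graph, and let $L$ be its graph Laplacian. For each $i\in\{1,\dots,n\}$ let $f_i:\mathbb{R}\to\mathbb{R}$ be an increasing (i.e. nondecreasing, not necessarily continuous) function with $\lim_{s\to+\infty}f_i(s)>0$ and $\lim_{s\to-\infty}f_i(s)<0$. Consider the differential inclusion $$\dot x(t)\in -L\,\Big(\mathcal{F}[f_1](x_1(t))\times\cdots\times\mathcal{F}[f_n](x_n(t))\Big),\qquad x(t)\in\mathbb{R}^n, \qquad (\ast)$$ and assume that for every initial condition a complete solution of $(\ast)$ exists. Then every complete Filippov solution $x:[0,\infty)\to\mathbb{R}^n$ of $(\ast)$, from any initial condition, converges asymptotically, as $t\to\infty$, to the set $$\mathcal{D}_1=\Big\{x\in\mathbb{R}^n \;\Big|\; \exists a\in\mathbb{R}\text{ such that } a\in\mathcal{F}[f_i](x_i)\text{ for all } i=1,\dots,n\Big\}.$$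
   Context: Graph conventions: a weighted digraph $\mathcal{G}=(\mathcal{V},\mathcal{E},A)$ has node set $\mathcal{V}=\{v_1,\dots,v_n\}$, edge set $\mathcal{E}\subseteq\mathcal{V}\times\mathcal{V}$, and weighted adjacency matrix $A=[a_{ij}]\in\mathbb{R}^{n\times n}$ with $a_{ij}\ge 0$, $a_{ii}=0$, and $a_{ij}>0$ if and only if $(v_j,v_i)\in\mathcal{E}$ (an edge from $v_j$ to $v_i$). The graph is undirected if $A=A^{\top}$. The Laplacian is $L=\Delta-A$, where $\Delta$ is diagonal with $\Delta_{ii}=\sum_{j=1}^n a_{ij}$. A digraph is strongly connected if for every two nodes $v_i,v_j$ there is a directed path from $v_i$ to $v_j$. Filippov map: for a map $X:\mathbb{R}^m\to\mathbb{R}^m$, $\mathcal{F}[X](x)=\bigcap_{\delta>0}\bigcap_{\mu(S)=0}\overline{\mathrm{co}}\{X(B(x,\delta)\setminus S)\}$, where $\mu$ is Lebesgue measure, $B(x,\delta)$ is the open ball, and $\overline{\mathrm{co}}$ is the closed convex hull. For a nondecreasing $\varphi:\mathbb{R}\to\mathbb{R}$ this is $\mathcal{F}[\varphi](s)=[\varphi(s^-),\varphi(s^+)]$, with one-sided limits. The inclusion $(\ast)$ is the Filippov interpretation of the system $\dot x=-Lf(x)$, $f(x)=[f_1(x_1),\dots,f_n(x_n)]^{\top}$. A (Filippov) solution of $(\ast)$ on an interval is a (locally) absolutely continuous function $x$ satisfying $(\ast)$ for almost every $t$ in that interval; it is complete if defined on $[0,\infty)$. A solution converges asymptotically to a set $D$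 if $\inf_{y\in D}\|x(t)-y\|\to 0$ as $t\to\infty$. The limits of $f_i$ at $\pm\infty$ are taken in the extended reals. *)

theory Defs
  imports "HOL-Analysis.Analysis"
begin

text \<open>The nodes are the elements of the finite type \<open>'n\<close>; the pair \<open>(j, i)\<close> is the edge
  from \<open>j\<close> to \<open>i\<close>, whose weight is \<open>A $ i $ j\<close> (receiving node first).\<close>

definition weighted_digraph :: "('n \<times> 'n) set \<Rightarrow> real ^ 'n ^ 'n \<Rightarrow> bool" where
  "weighted_digraph E A \<longleftrightarrow>
     (\<forall>i j. 0 \<le> A $ i $ j) \<and> (\<forall>i. A $ i $ i = 0) \<and>
     (\<forall>i j. 0 < A $ i $ j \<longleftrightarrow> (j, i) \<in> E)"

definition undirected :: "real ^ 'n ^ 'n \<Rightarrow> bool" where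
  "undirected A \<longleftrightarrow> A = transpose A"

definition strongly_connected :: "('n \<times> 'n) set \<Rightarrow> bool" where
  "strongly_connected E \<longleftrightarrow> (\<forall>i j. (i, j) \<in> E\<^sup>*)"

text \<open>Connectedness ignores the orientation of the edges.\<close>

definition connected_graph :: "('n \<times> 'n) set \<Rightarrow> bool" where
  "connected_graph E \<longleftrightarrow> (\<forall>i j. (i, j) \<in> (E \<union> E\<inverse>)\<^sup>*)"

definition degree_matrix :: "real ^ 'n ^ 'n \<Rightarrow> real ^ 'n ^ 'n" where
  "degree_matrix A = (\<chi> i j. if i = j then (\<Sum>k\<in>UNIV. A $ i $ k) else 0)"

definition laplacian :: "real ^ 'n ^ 'n \<Rightarrow> real ^ 'n ^ 'n" where
  "laplacian A = degree_matrix A - A"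

definition filippov :: "('a::euclidean_space \<Rightarrow> 'a) \<Rightarrow> 'a \<Rightarrow> 'a set" where
  "filippov X x =
     (\<Inter>\<delta>\<in>{0<..}. \<Inter>S\<in>null_sets lebesgue. closure (convex hull (X ` (ball x \<delta> - S))))"

text \<open>Absolute continuity on a compact interval; the intervals \<open>{u k<..<v k}\<close> may be empty,
  in which case they contribute nothing to either sum.\<close>

definition absolutely_continuous_on_interval ::
    "real \<Rightarrow> real \<Rightarrow> (real \<Rightarrow> 'a::real_normed_vector) \<Rightarrow> bool" where
  "absolutely_continuous_on_interval a b x \<longleftrightarrow>
     (\<forall>\<epsilon>>0. \<exists>\<delta>>0. \<forall>(m::nat) u v.
        (\<forall>k<m. a \<le> u k \<and> u k \<le> v k \<and> v k \<le> b) \<and>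
        disjoint_family_on (\<lambda>k. {u k<..<v k}) {..<m} \<and>
        (\<Sum>k<m. v k - u k) < \<delta> \<longrightarrow>
        (\<Sum>k<m. norm (x (v k) - x (u k))) < \<epsilon>)"

definition locally_absolutely_continuous_on ::
    "real set \<Rightarrow> (real \<Rightarrow> 'a::real_normed_vector) \<Rightarrow> bool" where
  "locally_absolutely_continuous_on I x \<longleftrightarrow>
     (\<forall>a b. a \<le> b \<and> {a..b} \<subseteq> I \<longrightarrow> absolutely_continuous_on_interval a b x)"

text \<open>Solutions on the interval \<open>I\<close> of the differential inclusion given by the set-valued
  vector field \<open>G\<close>; the values of \<open>x\<close> outside \<open>I\<close> play no role.\<close>

definition solution_on ::
    "('a::euclidean_space \<Rightarrow> 'a set) \<Rightarrow> real set \<Rightarrow> (real \<Rightarrow> 'a) \<Rightarrow> bool" where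
  "solution_on G I x \<longleftrightarrow>
     locally_absolutely_continuous_on I x \<and>
     (AE t in lebesgue. t \<in> I \<longrightarrow>
        (\<exists>v\<in>G (x t). (x has_vector_derivative v) (at t within I)))"

definition complete_solution ::
    "('a::euclidean_space \<Rightarrow> 'a set) \<Rightarrow> (real \<Rightarrow> 'a) \<Rightarrow> bool" where
  "complete_solution G x \<longleftrightarrow> solution_on G {0..} x"

text \<open>Since \<open>infdist y {} = 0\<close>, whereas the infimum over the empty set should be \<open>\<infinity>\<close>,
  nonemptiness is required explicitly.\<close>

definition converges_to_set :: "(real \<Rightarrow> 'a::metric_space) \<Rightarrow> 'a set \<Rightarrow> bool" where
  "converges_to_set x D \<longleftrightarrow> D \<noteq> {} \<and> ((\<lambda>t. infdist (x t) D) \<longlongrightarrow> 0) at_top"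

definition consensus_inclusion ::
    "real ^ 'n ^ 'n \<Rightarrow> ('n \<Rightarrow> real \<Rightarrow> real) \<Rightarrow> real ^ 'n \<Rightarrow> (real ^ 'n) set" where
  "consensus_inclusion A f x =
     (\<lambda>y. - (laplacian A *v y)) ` {y. \<forall>i. y $ i \<in> filippov (f i) (x $ i)}"

definition agreement_set :: "('n::finite \<Rightarrow> real \<Rightarrow> real) \<Rightarrow> (real ^ 'n) set" where
  "agreement_set f = {x. \<exists>a. \<forall>i. a \<in> filippov (f i) (x $ i)}"

end

theory Submission
  imports Defs
begin

text \<open>The graph is strongly connected in either case, so its Laplacian \<open>L\<close> has a left null vector \<open>w\<close>
  with positive entries. The Lyapunov function is the energy \<open>V(x) = \<Sum>i. w\<^sub>i \<Phi>\<^sub>i(x\<^sub>i)\<close>, where \<open>\<Phi>\<^sub>i\<close> is a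
  primitive of \<open>f\<^sub>i\<close>. If a solution moves at time \<open>t\<close> with velocity \<open>- L y\<close> for a selection \<open>y\<close> of the
  Filippov intervals, then for almost all such times \<open>V\<close> decreases at the rate
  \<open>y\<^sup>T diag(w) L y = 1/2 \<Sum>i j. w\<^sub>i a\<^sub>i\<^sub>j (y\<^sub>i - y\<^sub>j)\<^sup>2\<close>, which is nonnegative and vanishes only if all \<open>y\<^sub>i\<close> agree, that is,
  only if \<open>x(t)\<close> lies in the agreement set.

  The chain rule behind this (lemma \<open>energy_derivative_along_solution\<close>) is delicate only where \<open>f\<^sub>i\<close>
  jumps at \<open>x\<^sub>i(t)\<close>. There are countably many jumps, and \<open>x\<^sub>i\<close> passes each of them with nonzero speed at
  only countably many times; at all other times either \<open>\<Phi>\<^sub>i\<close> is differentiable at \<open>x\<^sub>i(t)\<close> or \<open>x\<^sub>i'(t) = 0\<close>.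
  Derivatives known almost everywhere turn into increments by absolute continuity
  (lemma \<open>increment_le_of_AE_derivative_le\<close>).

  The sign conditions on the limits of \<open>f\<^sub>i\<close> make \<open>V\<close> coercive, so the solution is bounded, its selections
  and velocities are bounded, and it is Lipschitz. They also give every \<open>f\<^sub>i\<close> a point whose Filippov
  interval contains \<open>0\<close>, so that the agreement set is nonempty. Since the graph of the selection map is
  closed, compactness bounds the dissipation below by a positive constant on the bounded
  states at distance at least \<open>\<epsilon>\<close> from the agreement set. A Lipschitz solution that returned to distance
  \<open>2 \<epsilon>\<close> at arbitrarily late times would dissipate a fixed amount of energy each time, which is impossible
  because \<open>V\<close> is bounded below.\<close>

section \<open>Absolutely continuous functions\<close>

text \<open>The defining sums run over initial segments of \<open>nat\<close>; enumerating a finite index set gives the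
  same estimate for the tagged intervals of a division.\<close>

lemma absolutely_continuous_family:
  assumes "absolutely_continuous_on_interval a b x" and "\<epsilon> > 0"
  obtains \<delta> where "\<delta> > 0"
    "\<And>S (u :: 'b \<Rightarrow> real) v. \<lbrakk>finite S; \<And>k. k \<in> S \<Longrightarrow> a \<le> u k \<and> u k \<le> v k \<and> v k \<le> b;
       disjoint_family_on (\<lambda>k. {u k<..<v k}) S; (\<Sum>k\<in>S. v k - u k) < \<delta>\<rbrakk>
       \<Longrightarrow> (\<Sum>k\<in>S. norm (x (v k) - x (u k))) < \<epsilon>"
proof -
  obtain \<delta> where \<delta>: "\<delta> > 0"
    and AC: "\<And>(m::nat) u v. \<lbrakk>\<forall>k<m. a \<le> u k \<and> u k \<le> v k \<and> v k \<le> b;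
        disjoint_family_on (\<lambda>k. {u k<..<v k}) {..<m}; (\<Sum>k<m. v k - u k) < \<delta>\<rbrakk>
        \<Longrightarrow> (\<Sum>k<m. norm (x (v k) - x (u k))) < \<epsilon>"
    using assms unfolding absolutely_continuous_on_interval_def by meson
  show thesis
  proof (rule that[OF \<delta>])
    fix S and u v :: "'b \<Rightarrow> real"
    assume S: "finite S" and uv: "\<And>k. k \<in> S \<Longrightarrow> a \<le> u k \<and> u k \<le> v k \<and> v k \<le> b"
      and dis: "disjoint_family_on (\<lambda>k. {u k<..<v k}) S" and less: "(\<Sum>k\<in>S. v k - u k) < \<delta>"
    obtain h where h: "bij_betw h {..<card S} S"
      using ex_bij_betw_nat_finite[OF S] by (auto simp: atLeast0LessThan)
    have hS: "h k \<in> S" if "k < card S" for k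
      using h that by (auto simp: bij_betw_def)
    have reindex: "(\<Sum>k<card S. F (h k)) = sum F S" for F :: "'b \<Rightarrow> real"
      by (rule sum.reindex_bij_betw[OF h])
    have "disjoint_family_on (\<lambda>k. {u (h k)<..<v (h k)}) {..<card S}"
      unfolding disjoint_family_on_def
    proof (intro ballI impI)
      fix i j assume ij: "i \<in> {..<card S}" "j \<in> {..<card S}" "i \<noteq> j"
      then have "h i \<noteq> h j" "h i \<in> S" "h j \<in> S"
        using h hS by (auto simp: bij_betw_def inj_on_def)
      then show "{u (h i)<..<v (h i)} \<inter> {u (h j)<..<v (h j)} = {}"
        using dis unfolding disjoint_family_on_def by blast
    qed
    then show "(\<Sum>k\<in>S. norm (x (v k) - x (u k))) < \<epsilon>"
      using AC[of "card S" "u \<circ> h" "v \<circ> h"] uv hS less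
        reindex[of "\<lambda>k. v k - u k"] reindex[of "\<lambda>k. norm (x (v k) - x (u k))"]
      by simp
  qed
qed

lemma absolutely_continuous_on_interval_imp_continuous_on:
  assumes "absolutely_continuous_on_interval a b x"
  shows "continuous_on {a..b} x"
  unfolding continuous_on_iff
proof (intro ballI allI impI)
  fix t \<epsilon> assume t: "t \<in> {a..b}" and "(\<epsilon>::real) > 0"
  then obtain \<delta> where "\<delta> > 0" and AC:
    "\<And>(S :: unit set) u v. \<lbrakk>finite S; \<And>k. k \<in> S \<Longrightarrow> a \<le> u k \<and> u k \<le> v k \<and> v k \<le> b;
       disjoint_family_on (\<lambda>k. {u k<..<v k}) S; (\<Sum>k\<in>S. v k - u k) < \<delta>\<rbrakk>
       \<Longrightarrow> (\<Sum>k\<in>S. norm (x (v k) - x (u k))) < \<epsilon>"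
    using absolutely_continuous_family[OF assms] by blast
  have "dist (x s) (x t) < \<epsilon>" if "s \<in> {a..b}" "dist s t < \<delta>" for s
    using AC[of "{()}" "\<lambda>_. min s t" "\<lambda>_. max s t"] t that
    by (cases "s \<le> t") (auto simp: disjoint_family_on_def dist_norm norm_minus_commute min_def max_def)
  then show "\<exists>d>0. \<forall>s\<in>{a..b}. dist s t < d \<longrightarrow> dist (x s) (x t) < \<epsilon>"
    using \<open>\<delta> > 0\<close> by blast
qed

text \<open>Used with \<open>x\<close> a solution and \<open>g\<close> its energy or one of its components. The Lipschitz bound
  compares values at two times, so a locally Lipschitz function of a bounded solution satisfies it.\<close>

lemma absolutely_continuous_on_interval_lipschitz_image:
  assumes AC: "absolutely_continuous_on_interval a b x"
    and lip: "\<And>s t. \<lbrakk>s \<in> {a..b}; t \<in> {a..b}\<rbrakk> \<Longrightarrow> norm (g t - g s) \<le> K * norm (x t - x s)"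
  shows "absolutely_continuous_on_interval a b g"
  unfolding absolutely_continuous_on_interval_def
proof (intro allI impI)
  fix \<epsilon> :: real assume "\<epsilon> > 0"
  define K' where "K' = \<bar>K\<bar> + 1"
  have K': "K' > 0" "K \<le> K'" by (auto simp: K'_def)
  then have "\<epsilon> / K' > 0" using \<open>\<epsilon> > 0\<close> by simp
  then obtain \<delta> where \<delta>: "\<delta> > 0"
    and *: "\<And>(m::nat) u v. \<lbrakk>\<forall>k<m. a \<le> u k \<and> u k \<le> v k \<and> v k \<le> b;
        disjoint_family_on (\<lambda>k. {u k<..<v k}) {..<m}; (\<Sum>k<m. v k - u k) < \<delta>\<rbrakk>
        \<Longrightarrow> (\<Sum>k<m. norm (x (v k) - x (u k))) < \<epsilon> / K'"
    using AC unfolding absolutely_continuous_on_interval_def by meson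
  show "\<exists>\<delta>>0. \<forall>(m::nat) u v. (\<forall>k<m. a \<le> u k \<and> u k \<le> v k \<and> v k \<le> b) \<and>
        disjoint_family_on (\<lambda>k. {u k<..<v k}) {..<m} \<and> (\<Sum>k<m. v k - u k) < \<delta> \<longrightarrow>
        (\<Sum>k<m. norm (g (v k) - g (u k))) < \<epsilon>"
  proof (intro exI[of _ \<delta>] conjI allI impI \<delta>, elim conjE)
    fix m :: nat and u v :: "nat \<Rightarrow> real"
    assume uv: "\<forall>k<m. a \<le> u k \<and> u k \<le> v k \<and> v k \<le> b"
      and dis: "disjoint_family_on (\<lambda>k. {u k<..<v k}) {..<m}" and less: "(\<Sum>k<m. v k - u k) < \<delta>"
    have "norm (g (v k) - g (u k)) \<le> K' * norm (x (v k) - x (u k))" if "k < m" for k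
    proof -
      have "u k \<in> {a..b}" "v k \<in> {a..b}" using uv that by (auto intro: order_trans)
      then have "norm (g (v k) - g (u k)) \<le> K * norm (x (v k) - x (u k))" by (rule lip)
      also have "\<dots> \<le> K' * norm (x (v k) - x (u k))"
        using K' by (intro mult_right_mono) auto
      finally show ?thesis .
    qed
    then have "(\<Sum>k<m. norm (g (v k) - g (u k))) \<le> K' * (\<Sum>k<m. norm (x (v k) - x (u k)))"
      by (auto simp: sum_distrib_left intro!: sum_mono)
    also have "\<dots> < K' * (\<epsilon> / K')"
      using *[OF uv dis less] K' by (intro mult_strict_left_mono) auto
    finally show "(\<Sum>k<m. norm (g (v k) - g (u k))) < \<epsilon>" using K' by simp
  qed
qed

text \<open>Straddle estimate: the increment over an interval around \<open>t\<close> splits at \<open>t\<close> into two increments,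
  each controlled by the derivative at \<open>t\<close>.\<close>

lemma derivative_bound_gauge:
  fixes g :: "real \<Rightarrow> real"
  assumes "(g has_real_derivative d) (at t within S)" "d \<le> M" "e > 0"
  obtains r where "r > 0"
    "\<And>u v. \<lbrakk>u \<in> S; v \<in> S; u \<le> t; t \<le> v; dist u t < r; dist v t < r\<rbrakk>
       \<Longrightarrow> g v - g u \<le> (M + e) * (v - u)"
proof -
  have "(g has_derivative (*) d) (at t within S)"
    using assms(1) by (simp add: has_field_derivative_def)
  then obtain r where r: "r > 0"
    and lin: "\<And>s. \<lbrakk>s \<in> S; norm (s - t) < r\<rbrakk> \<Longrightarrow> norm (g s - g t - d * (s - t)) \<le> e * norm (s - t)"
    using \<open>e > 0\<close> unfolding has_derivative_within_alt by blast
  show thesis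
  proof (rule that[OF r])
    fix u v assume *: "u \<in> S" "v \<in> S" "u \<le> t" "t \<le> v" "dist u t < r" "dist v t < r"
    have "g v - g t \<le> (d + e) * (v - t)" "g t - g u \<le> (d + e) * (t - u)"
      using lin[of v] lin[of u] * by (auto simp: dist_real_def algebra_simps abs_if split: if_splits)
    then have "g v - g u \<le> (d + e) * (v - u)" by (simp add: algebra_simps)
    also have "\<dots> \<le> (M + e) * (v - u)" using assms * by (intro mult_right_mono) auto
    finally show "g v - g u \<le> (M + e) * (v - u)" .
  qed
qed

lemma null_set_small_open_cover:
  fixes N :: "real set"
  assumes "N \<in> null_sets lebesgue" "\<delta> > 0"
  obtains T where "open T" "N \<subseteq> T" "T \<in> lmeasurable" "measure lebesgue T < \<delta>"
proof -
  obtain T where T: "open T" "N \<subseteq> T" "(T - N) \<in> lmeasurable" "emeasure lebesgue (T - N) < ennreal \<delta>"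
    using sets_lebesgue_outer_open[of N \<delta>] assms by auto
  have "emeasure lebesgue T = emeasure lebesgue (T - N)"
    using assms(1) T(1) by (simp add: emeasure_Diff_null_set borel_open)
  moreover have "T \<in> sets lebesgue" using T(1) by (simp add: borel_open)
  ultimately have em: "T \<in> sets lebesgue" "emeasure lebesgue T < ennreal \<delta>" using T(4) by auto
  then have fm: "T \<in> lmeasurable" by (auto simp: fmeasurable_def intro: less_trans ennreal_less_top)
  then have "measure lebesgue T < \<delta>"
    using em(2) \<open>\<delta> > 0\<close> by (simp add: emeasure_eq_measure2 ennreal_less_iff)
  with fm show thesis using T that by blast
qed

text \<open>This replaces the representation of an absolutely continuous function as the integral of its
  derivative. Take a tagged division finer than a gauge that enforces the straddle estimate at the good
  tags and keeps the intervals with bad tags inside an open set of small measure. The good intervals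
  contribute at most \<open>M + e\<close> times their length, and by absolute continuity the bad ones contribute
  at most \<open>e\<close> in total.\<close>

lemma increment_le_of_AE_derivative_le:
  fixes g :: "real \<Rightarrow> real"
  assumes "a \<le> b" and AC: "absolutely_continuous_on_interval a b g"
    and AE: "AE t in lebesgue. t \<in> {a..b} \<longrightarrow> (\<exists>d\<le>M. (g has_real_derivative d) (at t within {a..b}))"
  shows "g b - g a \<le> M * (b - a)"
proof -
  have main: "g b - g a \<le> M * (b - a) + e * (b - a + 2)" if e: "e > 0" for e
  proof -
    obtain \<delta> where \<delta>: "\<delta> > 0" and small:
      "\<And>S (u :: real \<times> real set \<Rightarrow> real) v. \<lbrakk>finite S; \<And>k. k \<in> S \<Longrightarrow> a \<le> u k \<and> u k \<le> v k \<and> v k \<le> b;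
       disjoint_family_on (\<lambda>k. {u k<..<v k}) S; (\<Sum>k\<in>S. v k - u k) < \<delta>\<rbrakk>
       \<Longrightarrow> (\<Sum>k\<in>S. norm (g (v k) - g (u k))) < e"
      using absolutely_continuous_family[OF AC e] by blast
    obtain N where N: "N \<in> null_sets lebesgue"
      and sub: "{t \<in> space lebesgue. \<not> (t \<in> {a..b} \<longrightarrow>
        (\<exists>d\<le>M. (g has_real_derivative d) (at t within {a..b})))} \<subseteq> N"
      using AE unfolding eventually_ae_filter by (elim bexE)
    have good: "\<exists>d\<le>M. (g has_real_derivative d) (at t within {a..b})" if "t \<notin> N" "t \<in> {a..b}" for t
      using subsetD[OF sub, of t] that by simp blast
    \<comment> \<open>The second bound keeps \<open>\<bar>M\<bar>\<close> times the total length of the intervals with bad tags below \<open>e\<close>,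
      which pays for extending the sum of \<open>M\<close> times the length to all intervals when \<open>M < 0\<close>.\<close>
    define \<delta>' where "\<delta>' = min \<delta> (e / (\<bar>M\<bar> + 1))"
    have \<delta>': "\<delta>' > 0" "\<delta>' \<le> \<delta>" using \<delta> e by (auto simp: \<delta>'_def add_nonneg_pos)
    have "\<delta>' * (\<bar>M\<bar> + 1) \<le> e / (\<bar>M\<bar> + 1) * (\<bar>M\<bar> + 1)"
      unfolding \<delta>'_def by (intro mult_right_mono) auto
    also have "\<dots> = e" using abs_ge_zero[of M] by (simp add: add_nonneg_eq_0_iff)
    finally have M\<delta>': "\<bar>M\<bar> * \<delta>' \<le> e" using \<delta>' by (simp add: algebra_simps)
    obtain T where T: "open T" "N \<subseteq> T" "T \<in> lmeasurable" "measure lebesgue T < \<delta>'"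
      using null_set_small_open_cover[OF N \<delta>'(1)] .
    have "\<exists>r>0. \<forall>u v. u \<in> {a..b} \<longrightarrow> v \<in> {a..b} \<longrightarrow> u \<le> t \<longrightarrow> t \<le> v \<longrightarrow> dist u t < r \<longrightarrow> dist v t < r
        \<longrightarrow> g v - g u \<le> (M + e) * (v - u)" if "t \<in> {a..b} - N" for t
    proof -
      from that good obtain d where "d \<le> M" "(g has_real_derivative d) (at t within {a..b})" by blast
      then show ?thesis using derivative_bound_gauge[of g d t "{a..b}" M e] that e by (smt (verit) DiffD1)
    qed
    then obtain r where r: "\<And>t. t \<in> {a..b} - N \<Longrightarrow> r t > 0"
      and r_bound: "\<And>t u v. \<lbrakk>t \<in> {a..b} - N; u \<in> {a..b}; v \<in> {a..b}; u \<le> t; t \<le> v; dist u t < r t; dist v t < r t\<rbrakk>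
        \<Longrightarrow> g v - g u \<le> (M + e) * (v - u)"
      by metis
    define \<gamma> where "\<gamma> t = (if t \<in> N then T else if t \<in> {a..b} then ball t (r t) else UNIV)" for t
    have "gauge \<gamma>" unfolding gauge_def \<gamma>_def using T r by auto
    then obtain p where p: "p tagged_division_of {a..b}" and fine: "\<gamma> fine p"
      by (rule fine_division_exists_real)
    have fin: "finite p" using p by auto
    have shape: "a \<le> Inf K \<and> Inf K \<le> t \<and> t \<le> Sup K \<and> Sup K \<le> b \<and> K = {Inf K..Sup K} \<and> K \<subseteq> \<gamma> t"
      if tK: "(t, K) \<in> p" for t K
    proof -
      obtain l h where "K = cbox l h" using tagged_division_ofD(4)[OF p tK] by blast
      moreover have "t \<in> K" "K \<subseteq> {a..b}" using tagged_division_ofD(2,3)[OF p tK] by auto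
      moreover have "K \<subseteq> \<gamma> t" using fine tK by (auto simp: fine_def)
      ultimately show ?thesis by auto
    qed
    \<comment> \<open>The intervals with bad tags.\<close>
    define q where "q = {k \<in> p. fst k \<in> N}"
    let ?len = "\<lambda>k :: real \<times> real set. Sup (snd k) - Inf (snd k)"
    let ?inc = "\<lambda>k :: real \<times> real set. g (Sup (snd k)) - g (Inf (snd k))"
    have finq: "finite q" using fin by (simp add: q_def)
    have dis: "disjoint_family_on (\<lambda>k. {Inf (snd k)<..<Sup (snd k)}) p"
      unfolding disjoint_family_on_def
    proof (intro ballI impI)
      fix k l assume kl: "k \<in> p" "l \<in> p" "k \<noteq> l"
      then have "interior (snd k) \<inter> interior (snd l) = {}"
        using tagged_division_ofD(5)[OF p, of "fst k" "snd k" "fst l" "snd l"] by (auto simp: prod_eq_iff)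
      moreover have "snd k = {Inf (snd k)..Sup (snd k)}" "snd l = {Inf (snd l)..Sup (snd l)}"
        using shape[of "fst k" "snd k"] shape[of "fst l" "snd l"] kl by auto
      ultimately show "{Inf (snd k)<..<Sup (snd k)} \<inter> {Inf (snd l)<..<Sup (snd l)} = {}"
        by (metis interior_atLeastAtMost_real)
    qed
    have disq: "disjoint_family_on (\<lambda>k. {Inf (snd k)<..<Sup (snd k)}) q"
      using dis by (rule disjoint_family_on_mono[rotated]) (auto simp: q_def)
    have le: "Inf (snd k) \<le> Sup (snd k)" if "k \<in> p" for k
      using shape[of "fst k" "snd k"] that by auto
    have "(\<Sum>k\<in>q. ?len k) = (\<Sum>k\<in>q. measure lebesgue {Inf (snd k)<..<Sup (snd k)})"
      using le by (intro sum.cong) (auto simp: q_def)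
    also have "\<dots> = measure lebesgue (\<Union>k\<in>q. {Inf (snd k)<..<Sup (snd k)})"
      using finq disq by (intro measure_UNION'[symmetric]) (auto simp: disjoint_family_on_def pairwise_def disjnt_def)
    also have "\<dots> \<le> measure lebesgue T"
    proof (rule measure_mono_fmeasurable)
      have "{Inf (snd k)<..<Sup (snd k)} \<subseteq> T" if "k \<in> q" for k
        using shape[of "fst k" "snd k"] that by (auto simp: q_def \<gamma>_def)
      then show "(\<Union>k\<in>q. {Inf (snd k)<..<Sup (snd k)}) \<subseteq> T" by blast
      have "open (\<Union>k\<in>q. {Inf (snd k)<..<Sup (snd k)})" by auto
      then show "(\<Union>k\<in>q. {Inf (snd k)<..<Sup (snd k)}) \<in> sets lebesgue"
        by (simp add: borel_open)
    qed (rule T)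
    also have "\<dots> < \<delta>'" by (rule T)
    finally have lenq: "(\<Sum>k\<in>q. ?len k) < \<delta>'" .
    have rangeq: "a \<le> Inf (snd k) \<and> Inf (snd k) \<le> Sup (snd k) \<and> Sup (snd k) \<le> b" if "k \<in> q" for k
      using shape[of "fst k" "snd k"] that by (auto simp: q_def)
    have badsum: "(\<Sum>k\<in>q. norm (?inc k)) < e"
      using small[OF finq, of "\<lambda>k. Inf (snd k)" "\<lambda>k. Sup (snd k)"] rangeq disq lenq \<delta>' by auto
    have pointwise: "?inc k \<le> (M + e) * ?len k + (if k \<in> q then norm (?inc k) + \<bar>M\<bar> * ?len k else 0)"
      if k: "k \<in> p" for k
    proof (cases "k \<in> q")
      case True
      have "0 \<le> (M + e + \<bar>M\<bar>) * ?len k" using e le[OF k] by (intro mult_nonneg_nonneg) auto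
      then show ?thesis using True by (simp add: algebra_simps)
    next
      case False
      have s: "a \<le> Inf (snd k)" "Inf (snd k) \<le> fst k" "fst k \<le> Sup (snd k)" "Sup (snd k) \<le> b"
          "snd k \<subseteq> \<gamma> (fst k)"
        using shape[of "fst k" "snd k"] k by auto
      have t: "fst k \<in> {a..b} - N" using False k s by (auto simp: q_def)
      have "snd k = {Inf (snd k)..Sup (snd k)}" using shape[of "fst k" "snd k"] k by auto
      then have "Inf (snd k) \<in> snd k" "Sup (snd k) \<in> snd k"
        using s(2,3) by (metis atLeastAtMost_iff order_trans order_refl)+
      then have "Inf (snd k) \<in> ball (fst k) (r (fst k))" "Sup (snd k) \<in> ball (fst k) (r (fst k))"
        using s(5) t by (auto simp: \<gamma>_def)
      then show ?thesis using r_bound[OF t, of "Inf (snd k)" "Sup (snd k)"] s False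
        by (auto simp: dist_commute)
    qed
    have "g b - g a = (\<Sum>k\<in>p. ?inc k)"
      using additive_tagged_division_1[OF \<open>a \<le> b\<close> p, of g] by (simp add: case_prod_unfold)
    also have "\<dots> \<le> (\<Sum>k\<in>p. (M + e) * ?len k + (if k \<in> q then norm (?inc k) + \<bar>M\<bar> * ?len k else 0))"
      by (intro sum_mono pointwise)
    also have "\<dots> = (M + e) * (\<Sum>k\<in>p. ?len k) + (\<Sum>k\<in>q. norm (?inc k) + \<bar>M\<bar> * ?len k)"
    proof -
      have "q = p \<inter> q" by (auto simp: q_def)
      then show ?thesis using fin by (simp add: sum.distrib sum_distrib_left sum.If_cases Int_absorb1)
    qed
    also have "\<dots> = (M + e) * (b - a) + ((\<Sum>k\<in>q. norm (?inc k)) + \<bar>M\<bar> * (\<Sum>k\<in>q. ?len k))"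
      using additive_tagged_division_1[OF \<open>a \<le> b\<close> p, of "\<lambda>x. x"]
      by (simp add: case_prod_unfold sum.distrib sum_distrib_left)
    also have "\<bar>M\<bar> * (\<Sum>k\<in>q. ?len k) \<le> \<bar>M\<bar> * \<delta>'"
      using lenq by (intro mult_left_mono) auto
    finally show ?thesis using badsum M\<delta>' by (simp add: algebra_simps)
  qed
  show ?thesis
  proof (rule field_le_epsilon)
    fix e :: real assume "e > 0"
    then show "g b - g a \<le> M * (b - a) + e"
      using main[of "e / (b - a + 2)"] \<open>a \<le> b\<close> by auto
  qed
qed

section \<open>Monotone functions, their Filippov maps and primitives\<close>

text \<open>For monotone \<open>f\<close> the values on a ball lie between those at its ends, and a null set
  cannot remove all points on either side of \<open>s\<close>. Describing the interval from \<open>f(s-)\<close> to \<open>f(s+)\<close> by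
  inequalities avoids one-sided limits and makes the closed graph below immediate.\<close>

lemma filippov_mono:
  fixes f :: "real \<Rightarrow> real"
  assumes "mono f"
  shows "filippov f s = {y. (\<forall>u<s. f u \<le> y) \<and> (\<forall>v>s. y \<le> f v)}"
proof (intro set_eqI iffI)
  fix y assume y: "y \<in> filippov f s"
  have between: "y \<in> {f (s - \<delta>)..f (s + \<delta>)}" if "\<delta> > 0" for \<delta>
  proof -
    have "y \<in> closure (convex hull (f ` (ball s \<delta> - {})))"
      using y that unfolding filippov_def by blast
    moreover have "closure (convex hull (f ` (ball s \<delta> - {}))) \<subseteq> {f (s - \<delta>)..f (s + \<delta>)}"
      using monoD[OF assms]
      by (intro closure_minimal hull_minimal) (auto simp: dist_real_def)
    ultimately show ?thesis by blast
  qed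
  have "f u \<le> y" if "u < s" for u using between[of "s - u"] that by simp
  moreover have "y \<le> f v" if "v > s" for v using between[of "v - s"] that by simp
  ultimately show "y \<in> {y. (\<forall>u<s. f u \<le> y) \<and> (\<forall>v>s. y \<le> f v)}" by blast
next
  fix y assume y: "y \<in> {y. (\<forall>u<s. f u \<le> y) \<and> (\<forall>v>s. y \<le> f v)}"
  have escape: "\<exists>u\<in>{a<..<b}. u \<notin> S" if "a < b" "S \<in> null_sets lebesgue" for a b :: real and S
  proof (rule ccontr)
    assume "\<not> ?thesis"
    then have "{a<..<b} \<subseteq> S" by blast
    then have "negligible {a<..<b}"
      using that(2) negligible_subset[of S] by (simp add: negligible_iff_null_sets)
    then show False using that(1) by (simp add: negligible_iff_measure)
  qed
  have "y \<in> closure (convex hull (f ` (ball s \<delta> - S)))" if \<delta>: "\<delta> > 0" and S: "S \<in> null_sets lebesgue" for \<delta> S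
  proof -
    obtain u v where "u \<in> {s-\<delta><..<s} - S" "v \<in> {s<..<s+\<delta>} - S"
      using escape[of "s - \<delta>" s, OF _ S] escape[of s "s + \<delta>", OF _ S] \<delta> by auto
    then have sub: "{f u, f v} \<subseteq> f ` (ball s \<delta> - S)" and uyv: "f u \<le> y" "y \<le> f v"
      using y by (auto simp: dist_real_def)
    have "y \<in> closed_segment (f u) (f v)" using uyv by (simp add: closed_segment_eq_real_ivl)
    then have "y \<in> convex hull (f ` (ball s \<delta> - S))"
      using hull_mono[OF sub, of convex] by (auto simp: segment_convex_hull)
    then show ?thesis using closure_subset by blast
  qed
  then show "y \<in> filippov f s" unfolding filippov_def by blast
qed

lemma filippov_mono_isCont:
  fixes f :: "real \<Rightarrow> real"
  assumes "mono f" "isCont f s" "y \<in> filippov f s"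
  shows "y = f s"
proof (rule antisym)
  have "(f \<longlongrightarrow> f s) (at_left s)" "(f \<longlongrightarrow> f s) (at_right s)"
    using assms(2) by (auto simp: isCont_def filterlim_at_split)
  then show "y \<le> f s" "f s \<le> y"
    using assms(3) unfolding filippov_mono[OF assms(1)]
    by (auto intro!: tendsto_lowerbound[of f "f s" "at_right s"] tendsto_upperbound[of f "f s" "at_left s"]
        simp: eventually_at_filter)
qed

text \<open>One of the two integrals is over an empty or degenerate interval and vanishes, so this is the
  oriented integral from \<open>0\<close> to \<open>s\<close>.\<close>

definition primitive :: "(real \<Rightarrow> real) \<Rightarrow> real \<Rightarrow> real" where
  "primitive f s = integral {0..s} f - integral {s..0} f"

lemma primitive_diff:
  assumes "mono f" "s \<le> t"
  shows "primitive f t - primitive f s = integral {s..t} f"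
proof -
  have int: "f integrable_on {a..b}" for a b
    using assms(1) by (intro integrable_on_mono_on) (auto simp: mono_def mono_on_def)
  have comb: "integral {a..b} f + integral {b..c} f = integral {a..c} f" if "a \<le> b" "b \<le> c" for a b c
    using Henstock_Kurzweil_Integration.integral_combine[OF that int] .
  have refl: "integral {a..a} f = 0" "a < b \<Longrightarrow> integral {b..a} f = 0" for a b by auto
  show ?thesis
    using comb[of 0 s t] comb[of s 0 t] comb[of s t 0] refl assms(2)
    unfolding primitive_def
    by (cases "0 \<le> s"; cases "0 \<le> t"; cases "s = 0"; cases "t = 0") (auto simp del: atLeastatMost_empty_iff)
qed

text \<open>Everything used about the primitive (convexity, local Lipschitz continuity, differentiability
  where \<open>f\<close> is continuous, growth) follows from these two bounds.\<close>

lemma primitive_increment_bounds: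
  assumes "mono f" "s \<le> t"
  shows "f s * (t - s) \<le> primitive f t - primitive f s"
    and "primitive f t - primitive f s \<le> f t * (t - s)"
proof -
  have int: "f integrable_on {s..t}"
    using assms(1) by (intro integrable_on_mono_on) (auto simp: mono_def mono_on_def)
  have "integral {s..t} (\<lambda>_. f s) \<le> integral {s..t} f" "integral {s..t} f \<le> integral {s..t} (\<lambda>_. f t)"
    using monoD[OF assms(1)] integral_le[of "\<lambda>_. f s" "{s..t}" f] integral_le[of f "{s..t}" "\<lambda>_. f t"] int
      integrable_const_ivl[of "f s" s t] integrable_const_ivl[of "f t" s t]
    by (simp_all del: integral_const_real)
  then show "f s * (t - s) \<le> primitive f t - primitive f s"
    "primitive f t - primitive f s \<le> f t * (t - s)"
    using primitive_diff[OF assms] assms(2) by (auto simp: mult.commute)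
qed

lemma primitive_tangent:
  assumes "mono f"
  shows "primitive f s + f s * (t - s) \<le> primitive f t"
  using primitive_increment_bounds[OF assms, of s t] primitive_increment_bounds[OF assms, of t s]
  by (cases "s \<le> t") (auto simp: algebra_simps)

text \<open>The primitive lies above its tangents at \<open>a\<close> and \<open>b\<close>, whose slopes have opposite signs.\<close>

lemma primitive_coercive:
  assumes "mono f" and signs: "f a < 0" "f b > 0"
  obtains c C where "c > 0" "\<And>s. c * \<bar>s\<bar> - C \<le> primitive f s"
proof
  let ?c = "min (f b) (- f a)"
  let ?C = "max (f b * b - primitive f b) (f a * a - primitive f a)"
  show "?c > 0" using signs by simp
  fix s
  have "?c * \<bar>s\<bar> \<le> max (f b * s) (f a * s)"
  proof (cases "s \<ge> 0")
    case True
    then have "?c * s \<le> f b * s" by (intro mult_right_mono) auto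
    with True show ?thesis by simp
  next
    case False
    then have "?c * (- s) \<le> (- f a) * (- s)" by (intro mult_right_mono) auto
    with False show ?thesis by simp
  qed
  then show "?c * \<bar>s\<bar> - ?C \<le> primitive f s"
    using primitive_tangent[OF assms(1), of a s] primitive_tangent[OF assms(1), of b s]
    by (auto simp: algebra_simps)
qed

text \<open>The point is the place where \<open>f\<close> changes sign.\<close>

lemma zero_in_filippov_mono:
  fixes f :: "real \<Rightarrow> real"
  assumes f: "mono f" and signs: "f a < 0" "f b > 0"
  obtains p where "0 \<in> filippov f p"
proof
  let ?N = "{s. f s < 0}"
  have "s \<le> b" if "f s < 0" for s
    using monoD[OF f, of b s] that signs(2) by linarith
  then have bdd: "bdd_above ?N" by (intro bdd_aboveI[of _ b]) auto
  have "f u \<le> 0" if u: "u < Sup ?N" for u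
  proof -
    obtain s where "f s < 0" "u < s"
      using less_cSupD[OF _ u] signs(1) by blast
    then show ?thesis using monoD[OF f, of u s] by linarith
  qed
  moreover have "0 \<le> f v" if "v > Sup ?N" for v
    using cSup_upper[OF _ bdd, of v] that by (meson leD leI mem_Collect_eq)
  ultimately show "0 \<in> filippov f (Sup ?N)" by (simp add: filippov_mono[OF f])
qed

lemma primitive_lipschitz:
  assumes "mono f" "\<bar>s\<bar> \<le> R" "\<bar>t\<bar> \<le> R"
  shows "\<bar>primitive f t - primitive f s\<bar> \<le> (\<bar>f R\<bar> + \<bar>f (- R)\<bar>) * \<bar>t - s\<bar>"
proof -
  have *: "\<bar>primitive f t - primitive f s\<bar> \<le> (\<bar>f R\<bar> + \<bar>f (- R)\<bar>) * (t - s)"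
    if "s \<le> t" "\<bar>s\<bar> \<le> R" "\<bar>t\<bar> \<le> R" for s t
  proof -
    have "f (- R) \<le> f s" "f t \<le> f R" using that by (auto intro!: monoD[OF assms(1)])
    then have "f (- R) * (t - s) \<le> f s * (t - s)" "f t * (t - s) \<le> f R * (t - s)"
      using that by (auto intro!: mult_right_mono)
    moreover have "f R * (t - s) \<le> \<bar>f R\<bar> * (t - s)" "- (\<bar>f (- R)\<bar> * (t - s)) \<le> f (- R) * (t - s)"
      "0 \<le> \<bar>f R\<bar> * (t - s)" "0 \<le> \<bar>f (- R)\<bar> * (t - s)"
      using that(1) mult_right_mono[of "- \<bar>f (- R)\<bar>" "f (- R)" "t - s"] by (auto intro!: mult_right_mono)
    ultimately show ?thesis using primitive_increment_bounds[OF assms(1) that(1)]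
      unfolding abs_le_iff distrib_right by linarith
  qed
  show ?thesis
    using *[of s t] *[of t s] assms by (cases "s \<le> t") (auto simp: abs_minus_commute)
qed

lemma primitive_has_derivative:
  assumes "mono f" "isCont f s"
  shows "(primitive f has_real_derivative f s) (at s)"
  unfolding has_field_derivative_def has_derivative_within_alt
proof (intro conjI allI impI bounded_linear_mult_right)
  fix e :: real assume "e > 0"
  then obtain d where "d > 0" and d: "\<And>t. dist t s < d \<Longrightarrow> dist (f t) (f s) < e"
    using assms(2) by (auto simp: continuous_at_eps_delta)
  have "norm (primitive f t - primitive f s - f s * (t - s)) \<le> e * norm (t - s)" if "norm (t - s) < d" for t
  proof -
    have ft: "\<bar>f t - f s\<bar> < e" using d[of t] that by (simp add: dist_real_def)
    then have "\<bar>f t - f s\<bar> * \<bar>t - s\<bar> \<le> e * \<bar>t - s\<bar>" by (intro mult_right_mono) auto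
    moreover have "\<bar>primitive f t - primitive f s - f s * (t - s)\<bar> \<le> \<bar>(f t - f s) * (t - s)\<bar>"
      using primitive_increment_bounds[OF assms(1), of s t] primitive_increment_bounds[OF assms(1), of t s]
      by (cases "s \<le> t") (auto simp: algebra_simps abs_le_iff)
    ultimately show ?thesis by (simp add: abs_mult)
  qed
  then show "\<exists>d>0. \<forall>t\<in>UNIV. norm (t - s) < d \<longrightarrow>
      norm (primitive f t - primitive f s - f s * (t - s)) \<le> e * norm (t - s)"
    using \<open>d > 0\<close> by blast
qed

text \<open>The primitive need not be differentiable where \<open>f\<close> jumps. If \<open>\<phi>\<close> has derivative zero there, local
  Lipschitz continuity still gives the composition derivative zero, so every selected value \<open>y\<close> yields
  the correct product.\<close>

lemma primitive_chain_rule: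
  assumes f: "mono f" and y: "y \<in> filippov f (\<phi> t)"
    and \<phi>: "(\<phi> has_real_derivative d) (at t within I)" and alternative: "d = 0 \<or> isCont f (\<phi> t)"
  shows "((\<lambda>s. primitive f (\<phi> s)) has_real_derivative y * d) (at t within I)"
proof (cases "isCont f (\<phi> t)")
  case True
  then show ?thesis
    using DERIV_chain2[OF primitive_has_derivative[OF f True] \<phi>] filippov_mono_isCont[OF f True y] by simp
next
  case False
  with alternative have "d = 0" by simp
  \<comment> \<open>Near \<open>t\<close> the values of \<open>\<phi>\<close> stay below \<open>R\<close>, where the primitive has Lipschitz constant \<open>K\<close>.\<close>
  define R where "R = \<bar>\<phi> t\<bar> + 1"
  define K where "K = \<bar>f R\<bar> + \<bar>f (- R)\<bar>"
  have "(\<phi> \<longlongrightarrow> \<phi> t) (at t within I)"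
    using DERIV_continuous[OF \<phi>] by (simp add: continuous_within)
  then have "eventually (\<lambda>s. dist (\<phi> s) (\<phi> t) < 1) (at t within I)" by (rule tendstoD) simp
  then have "eventually (\<lambda>s. \<bar>\<phi> s\<bar> \<le> R) (at t within I)"
    by eventually_elim (auto simp: R_def dist_real_def)
  then have bound: "eventually (\<lambda>s. norm ((primitive f (\<phi> s) - primitive f (\<phi> t)) / (s - t))
      \<le> norm ((\<phi> s - \<phi> t) / (s - t)) * K) (at t within I)"
  proof eventually_elim
    case (elim s)
    have "\<bar>primitive f (\<phi> s) - primitive f (\<phi> t)\<bar> \<le> K * \<bar>\<phi> s - \<phi> t\<bar>"
      using primitive_lipschitz[OF f _ elim, of "\<phi> t"] by (simp add: R_def K_def)
    then show ?case by (simp add: divide_right_mono mult.commute)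
  qed
  have "((\<lambda>s. (\<phi> s - \<phi> t) / (s - t)) \<longlongrightarrow> 0) (at t within I)"
    using \<phi> \<open>d = 0\<close> by (simp add: has_field_derivative_iff)
  then have "((\<lambda>s. (primitive f (\<phi> s) - primitive f (\<phi> t)) / (s - t)) \<longlongrightarrow> 0) (at t within I)"
    by (rule tendsto_0_le) (rule bound)
  then show ?thesis using \<open>d = 0\<close> by (simp add: has_field_derivative_iff)
qed

text \<open>Distinct isolated points are separated by distinct members of a countable base.\<close>

lemma countable_if_all_points_isolated:
  fixes S :: "'a::second_countable_topology set"
  assumes "\<And>x. x \<in> S \<Longrightarrow> \<exists>T. open T \<and> T \<inter> S = {x}"
  shows "countable S"
proof -
  obtain B :: "'a set set" where B: "countable B" "topological_basis B"
    using ex_countable_basis by blast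
  have "\<exists>b\<in>B. b \<inter> S = {x}" if x: "x \<in> S" for x
  proof -
    obtain T where T: "open T" "T \<inter> S = {x}" using assms[OF x] by blast
    then obtain b where "b \<in> B" "x \<in> b" "b \<subseteq> T"
      using topological_basisE[OF B(2), of T x] by blast
    then show ?thesis using T x by blast
  qed
  then obtain b where b: "\<And>x. x \<in> S \<Longrightarrow> b x \<in> B \<and> b x \<inter> S = {x}" by metis
  then have "inj_on b S" by (metis inj_onI singleton_inject)
  moreover have "countable (b ` S)" using b B(1) by (meson countable_subset image_subsetI)
  ultimately show ?thesis by (rule countable_image_inj_on[rotated])
qed

text \<open>A point of a level set with nonzero derivative is isolated in that level set.\<close>

lemma countable_nonzero_derivative_on_level_set:
  fixes \<phi> :: "real \<Rightarrow> real"
  shows "countable {t \<in> I. \<phi> t = c \<and> (\<exists>d. d \<noteq> 0 \<and> (\<phi> has_real_derivative d) (at t within I))}"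
    (is "countable ?S")
proof (rule countable_if_all_points_isolated)
  fix t assume "t \<in> ?S"
  then obtain d where t: "t \<in> I" "\<phi> t = c" and d: "d \<noteq> 0" "(\<phi> has_real_derivative d) (at t within I)" by blast
  have "eventually (\<lambda>s. (\<phi> s - \<phi> t) / (s - t) \<noteq> 0) (at t within I)"
    using d by (intro tendsto_imp_eventually_ne[of _ d]) (auto simp: has_field_derivative_iff)
  then obtain T where "open T" "t \<in> T" "\<And>s. \<lbrakk>s \<in> T; s \<noteq> t; s \<in> I\<rbrakk> \<Longrightarrow> \<phi> s \<noteq> c"
    using t unfolding eventually_at_topological by auto
  then show "\<exists>T. open T \<and> T \<inter> ?S = {t}" using \<open>t \<in> ?S\<close> by (intro exI[of _ T]) auto
qed

text \<open>A monotone \<open>f\<close> has countably many jumps, and \<open>\<phi>\<close> crosses each of them with nonzero speed at only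
  countably many times. Hence the chain rule for the primitive applies at almost every time.\<close>

lemma AE_zero_derivative_or_isCont:
  fixes \<phi> f :: "real \<Rightarrow> real"
  assumes "mono f"
  shows "AE t in lebesgue. t \<in> I \<longrightarrow> (\<forall>d. (\<phi> has_real_derivative d) (at t within I) \<longrightarrow> d = 0 \<or> isCont f (\<phi> t))"
proof -
  define S where "S = (\<Union>c\<in>{c. \<not> isCont f c}.
    {t \<in> I. \<phi> t = c \<and> (\<exists>d. d \<noteq> 0 \<and> (\<phi> has_real_derivative d) (at t within I))})"
  have "countable S"
    unfolding S_def
    by (intro countable_UN[OF mono_ctble_discont[OF assms]] countable_nonzero_derivative_on_level_set)
  then have "S \<in> null_sets lebesgue"
    by (intro null_sets_completionI countable_imp_null_set_lborel)
  then show ?thesis by (rule AE_I') (auto simp: S_def)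
qed

section \<open>Left null vectors of the Laplacian and the disagreement form\<close>

lemma laplacian_mult_component:
  fixes A :: "real ^ 'n ^ 'n"
  shows "(laplacian A *v y) $ i = (\<Sum>j\<in>UNIV. A $ i $ j * (y $ i - y $ j))"
proof -
  have "(laplacian A *v y) $ i =
      (\<Sum>j\<in>UNIV. (if i = j then (\<Sum>k\<in>UNIV. A $ i $ k) else 0) * y $ j) - (\<Sum>j\<in>UNIV. A $ i $ j * y $ j)"
    by (simp add: laplacian_def degree_matrix_def matrix_vector_mult_def left_diff_distrib sum_subtractf)
  also have "(\<Sum>j\<in>UNIV. (if i = j then (\<Sum>k\<in>UNIV. A $ i $ k) else 0) * y $ j)
      = (\<Sum>j\<in>UNIV. if i = j then (\<Sum>k\<in>UNIV. A $ i $ k) * y $ j else 0)"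
    by (intro sum.cong) auto
  also have "\<dots> = (\<Sum>k\<in>UNIV. A $ i $ k) * y $ i" by simp
  finally show ?thesis
    by (simp add: right_diff_distrib sum_subtractf sum_distrib_right)
qed

text \<open>Equivalently \<open>w\<^sup>T L = 0\<close>: at every node the weighted outflow balances the weighted inflow.\<close>

definition left_null_weights :: "real ^ 'n ^ 'n \<Rightarrow> ('n \<Rightarrow> real) \<Rightarrow> bool" where
  "left_null_weights A w \<longleftrightarrow>
     (\<forall>j. (\<Sum>i\<in>UNIV. w i * A $ i $ j) = w j * (\<Sum>k\<in>UNIV. A $ j $ k))"

text \<open>The rows of the Laplacian sum to zero, so it is singular, and hence so is its transpose.\<close>

lemma nonzero_left_null_weights:
  fixes A :: "real ^ 'n ^ 'n"
  obtains w i where "left_null_weights A w" "w i \<noteq> 0"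
proof -
  let ?L = "laplacian A"
  have "?L *v (\<chi> i. (1 :: real)) = 0" by (simp add: vec_eq_iff laplacian_mult_component)
  moreover have "(\<chi> i. (1 :: real)) \<noteq> (0 :: real ^ 'n)" by (simp add: vec_eq_iff)
  ultimately have "\<not> invertible ?L"
    by (metis invertible_left_inverse matrix_left_invertible_ker)
  then have "\<not> invertible (transpose ?L)"
    by (metis transpose_invertible transpose_transpose)
  then obtain z where z: "transpose ?L *v z = 0" "z \<noteq> 0"
    by (metis invertible_left_inverse matrix_left_invertible_ker)
  have "(\<Sum>i\<in>UNIV. z $ i * A $ i $ j) = z $ j * (\<Sum>k\<in>UNIV. A $ j $ k)" for j
  proof -
    have "0 = (\<Sum>i\<in>UNIV. (if i = j then (\<Sum>k\<in>UNIV. A $ i $ k) else 0) * z $ i - A $ i $ j * z $ i)"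
      using arg_cong[OF z(1), of "\<lambda>v. v $ j"]
      by (simp add: laplacian_def degree_matrix_def matrix_vector_mult_def transpose_def left_diff_distrib)
    also have "\<dots> = (\<Sum>i\<in>UNIV. (if i = j then (\<Sum>k\<in>UNIV. A $ j $ k) * z $ j else 0)) - (\<Sum>i\<in>UNIV. A $ i $ j * z $ i)"
      unfolding sum_subtractf by (intro arg_cong2[where f = minus] sum.cong) auto
    finally show ?thesis by (simp add: mult.commute)
  qed
  moreover obtain i where "z $ i \<noteq> 0" using z(2) by (auto simp: vec_eq_iff)
  ultimately show thesis by (intro that[of "\<lambda>i. z $ i" i]) (auto simp: left_null_weights_def)
qed

text \<open>A Perron-Frobenius argument. The absolute values of a nonzero left null vector satisfy the balance
  equations as inequalities. Summing over all nodes gives equality, so each inequality is an equality.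
  If a weight vanished at a node, balance there would make it vanish at all nodes reached by an
  edge from it, and by strong connectivity everywhere.\<close>

lemma positive_left_null_weights:
  fixes A :: "real ^ 'n ^ 'n"
  assumes G: "weighted_digraph E A" and sc: "strongly_connected E"
  obtains w where "left_null_weights A w" "\<And>i. w i > 0"
proof -
  have A: "A $ i $ j \<ge> 0" "(j, i) \<in> E \<Longrightarrow> A $ i $ j > 0" for i j
    using G by (auto simp: weighted_digraph_def)
  obtain w i0 where w: "left_null_weights A w" and i0: "w i0 \<noteq> 0"
    by (rule nonzero_left_null_weights)
  define d where "d j = (\<Sum>k\<in>UNIV. A $ j $ k)" for j
  have d: "d j \<ge> 0" for j unfolding d_def by (intro sum_nonneg A)
  have wd: "(\<Sum>i\<in>UNIV. w i * A $ i $ j) = w j * d j" for j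
    using w by (simp add: left_null_weights_def d_def)
  have le: "\<bar>w j\<bar> * d j \<le> (\<Sum>i\<in>UNIV. \<bar>w i\<bar> * A $ i $ j)" for j
  proof -
    have "\<bar>w j\<bar> * d j = \<bar>\<Sum>i\<in>UNIV. w i * A $ i $ j\<bar>" unfolding wd using d by (simp add: abs_mult)
    also have "\<dots> \<le> (\<Sum>i\<in>UNIV. \<bar>w i * A $ i $ j\<bar>)" by (rule sum_abs)
    finally show ?thesis using A by (simp add: abs_mult)
  qed
  \<comment> \<open>Both sides weigh every edge once by the weight of its head.\<close>
  have total: "(\<Sum>j\<in>UNIV. \<Sum>i\<in>UNIV. \<bar>w i\<bar> * A $ i $ j) = (\<Sum>j\<in>UNIV. \<bar>w j\<bar> * d j)"
    by (subst sum.swap) (simp add: d_def sum_distrib_left)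
  have eq: "(\<Sum>i\<in>UNIV. \<bar>w i\<bar> * A $ i $ j) = \<bar>w j\<bar> * d j" for j
  proof (rule ccontr)
    assume "\<not> ?thesis"
    then have "(\<Sum>j\<in>UNIV. \<bar>w j\<bar> * d j) < (\<Sum>j\<in>UNIV. \<Sum>i\<in>UNIV. \<bar>w i\<bar> * A $ i $ j)"
      using le by (intro sum_strict_mono_ex1) (auto simp: less_le intro!: exI[of _ j])
    with total show False by simp
  qed
  have predecessor: "w i = 0" if "(j, i) \<in> E" "w j = 0" for i j
  proof -
    have "(\<Sum>i\<in>UNIV. \<bar>w i\<bar> * A $ i $ j) = 0" using eq[of j] that by simp
    then have "\<bar>w i\<bar> * A $ i $ j = 0"
      using A by (subst (asm) sum_nonneg_eq_0_iff) auto
    then show ?thesis using A(2)[OF that(1)] by simp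
  qed
  have "w j \<noteq> 0" for j
  proof
    assume "w j = 0"
    have "(j, i0) \<in> E\<^sup>*" using sc by (simp add: strongly_connected_def)
    then have "w i0 = 0" by (induction rule: rtrancl_induct) (use \<open>w j = 0\<close> predecessor in auto)
    with i0 show False by simp
  qed
  then show thesis
    by (intro that[of "\<lambda>i. \<bar>w i\<bar>"]) (use eq in \<open>auto simp: left_null_weights_def d_def\<close>)
qed

text \<open>In a symmetric graph the edge relation is its own converse.\<close>

lemma undirected_connected_imp_strongly_connected:
  assumes "weighted_digraph E A" "undirected A" "connected_graph E"
  shows "strongly_connected E"
proof -
  have "A = transpose A" using assms(2) unfolding undirected_def .
  then have "A $ i $ j = transpose A $ i $ j" for i j by (rule arg_cong)
  then have sym: "A $ i $ j = A $ j $ i" for i j by (simp add: transpose_def)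
  have "(j, i) \<in> E \<longleftrightarrow> (i, j) \<in> E" for i j
    using assms(1) sym[of i j] unfolding weighted_digraph_def by metis
  then have "E\<inverse> = E" by auto
  then show ?thesis using assms(3) by (simp add: connected_graph_def strongly_connected_def)
qed

definition disagreement :: "real ^ 'n ^ 'n \<Rightarrow> ('n \<Rightarrow> real) \<Rightarrow> real ^ 'n \<Rightarrow> real" where
  "disagreement A w y = (\<Sum>i\<in>UNIV. \<Sum>j\<in>UNIV. w i * A $ i $ j * (y $ i - y $ j)\<^sup>2) / 2"

text \<open>Write \<open>y\<^sub>i (y\<^sub>i - y\<^sub>j)\<close> as half of \<open>(y\<^sub>i - y\<^sub>j)\<^sup>2 + y\<^sub>i\<^sup>2 - y\<^sub>j\<^sup>2\<close>; the last two terms cancel in the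
  weighted sum because \<open>w\<close> is balanced.\<close>

lemma weighted_laplacian_form:
  assumes "left_null_weights A w"
  shows "(\<Sum>i\<in>UNIV. w i * (y $ i * (laplacian A *v y) $ i)) = disagreement A w y"
proof -
  have "w i * (y $ i * (laplacian A *v y) $ i) =
      (\<Sum>j\<in>UNIV. w i * A $ i $ j * (y $ i - y $ j)\<^sup>2 / 2 + w i * A $ i $ j * (y $ i)\<^sup>2 / 2
         - w i * A $ i $ j * (y $ j)\<^sup>2 / 2)" for i
    unfolding laplacian_mult_component sum_distrib_left
    by (intro sum.cong refl) (simp add: power2_eq_square field_simps)
  then have "(\<Sum>i\<in>UNIV. w i * (y $ i * (laplacian A *v y) $ i)) = disagreement A w y
      + (\<Sum>i\<in>UNIV. \<Sum>j\<in>UNIV. w i * A $ i $ j * (y $ i)\<^sup>2 / 2)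
      - (\<Sum>i\<in>UNIV. \<Sum>j\<in>UNIV. w i * A $ i $ j * (y $ j)\<^sup>2 / 2)"
    by (simp add: disagreement_def sum.distrib sum_subtractf sum_divide_distrib)
  moreover have "(\<Sum>i\<in>UNIV. \<Sum>j\<in>UNIV. w i * A $ i $ j * (y $ j)\<^sup>2 / 2)
      = (\<Sum>j\<in>UNIV. (\<Sum>i\<in>UNIV. w i * A $ i $ j) * ((y $ j)\<^sup>2 / 2))"
    by (subst sum.swap) (simp add: sum_distrib_right sum_divide_distrib)
  moreover have "\<dots> = (\<Sum>j\<in>UNIV. \<Sum>k\<in>UNIV. w j * A $ j $ k * (y $ j)\<^sup>2 / 2)"
    using assms by (simp add: left_null_weights_def sum_distrib_left sum_distrib_right sum_divide_distrib)
  ultimately show ?thesis by simp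
qed

lemma disagreement_nonneg:
  assumes "weighted_digraph E A" "\<And>i. w i > 0"
  shows "disagreement A w y \<ge> 0"
  using assms less_imp_le[OF assms(2)]
  by (auto simp: disagreement_def weighted_digraph_def intro!: divide_nonneg_pos sum_nonneg mult_nonneg_nonneg)

text \<open>Every summand vanishes, so \<open>y\<close> is constant along edges and therefore along directed paths.\<close>

lemma disagreement_eq_0_imp_equal:
  assumes G: "weighted_digraph E A" and sc: "strongly_connected E" and w: "\<And>i. w i > 0"
    and zero: "disagreement A w y = 0"
  shows "y $ i = y $ j"
proof -
  have A: "A $ i $ j \<ge> 0" "(j, i) \<in> E \<Longrightarrow> A $ i $ j > 0" for i j
    using G by (auto simp: weighted_digraph_def)
  have nn: "w i * A $ i $ j * (y $ i - y $ j)\<^sup>2 \<ge> 0" for i j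
    using A(1) less_imp_le[OF w] by (intro mult_nonneg_nonneg) auto
  have "\<forall>i\<in>UNIV. (\<Sum>j\<in>UNIV. w i * A $ i $ j * (y $ i - y $ j)\<^sup>2) = 0"
    using zero nn unfolding disagreement_def
    by (subst sum_nonneg_eq_0_iff[symmetric]) (auto intro!: sum_nonneg)
  then have all0: "w i * A $ i $ j * (y $ i - y $ j)\<^sup>2 = 0" for i j
    using nn by (subst (asm) sum_nonneg_eq_0_iff) auto
  have edge: "y $ i = y $ j" if "(j, i) \<in> E" for i j
    using all0[of i j] A(2)[OF that] w[of i] by simp
  have "(i, j) \<in> E\<^sup>*" using sc by (simp add: strongly_connected_def)
  then show ?thesis by (induction rule: rtrancl_induct) (auto simp: edge)
qed

lemma continuous_on_disagreement [continuous_intros]: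
  "continuous_on S g \<Longrightarrow> continuous_on S (\<lambda>z. disagreement A w (g z))"
  unfolding disagreement_def by (intro continuous_intros) auto

section \<open>Energy along solutions\<close>

abbreviation selection :: "('n \<Rightarrow> real \<Rightarrow> real) \<Rightarrow> real ^ 'n \<Rightarrow> real ^ 'n \<Rightarrow> bool" where
  "selection f z y \<equiv> \<forall>i. y $ i \<in> filippov (f i) (z $ i)"

definition energy :: "('n \<Rightarrow> real) \<Rightarrow> ('n \<Rightarrow> real \<Rightarrow> real) \<Rightarrow> real ^ 'n \<Rightarrow> real" where
  "energy w f z = (\<Sum>i\<in>UNIV. w i * primitive (f i) (z $ i))"

lemma has_real_derivative_vec_nth:
  fixes x :: "real \<Rightarrow> real ^ 'n"
  assumes "(x has_vector_derivative v) (at t within I)"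
  shows "((\<lambda>t. x t $ i) has_real_derivative v $ i) (at t within I)"
  using bounded_linear.has_vector_derivative[OF bounded_linear_vec_nth assms]
  by (simp add: has_real_derivative_iff_has_vector_derivative)

text \<open>By the componentwise chain rule the energy has derivative \<open>\<Sum>i. w\<^sub>i y\<^sub>i x\<^sub>i'\<close>, where \<open>y\<close> is the very
  selection that realises the velocity \<open>x' = - L y\<close>.\<close>

lemma energy_derivative_along_solution:
  fixes A :: "real ^ 'n ^ 'n" and x :: "real \<Rightarrow> real ^ 'n"
  assumes mono: "\<And>i. mono (f i)" and w: "left_null_weights A w"
    and sol: "solution_on (consensus_inclusion A f) I x"
  shows "AE t in lebesgue. t \<in> I \<longrightarrow> (\<exists>y. selection f (x t) y \<and>
    (x has_vector_derivative - (laplacian A *v y)) (at t within I) \<and>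
    ((\<lambda>t. energy w f (x t)) has_real_derivative - disagreement A w y) (at t within I))"
proof -
  have vel: "AE t in lebesgue. t \<in> I \<longrightarrow>
      (\<exists>v\<in>consensus_inclusion A f (x t). (x has_vector_derivative v) (at t within I))"
    using sol by (simp add: solution_on_def)
  have reg: "AE t in lebesgue. \<forall>i\<in>UNIV. t \<in> I \<longrightarrow>
      (\<forall>d. ((\<lambda>t. x t $ i) has_real_derivative d) (at t within I) \<longrightarrow> d = 0 \<or> isCont (f i) (x t $ i))"
    by (intro AE_finite_allI AE_zero_derivative_or_isCont mono finite)
  show ?thesis
    using vel reg
  proof eventually_elim
    case (elim t)
    show ?case
    proof
      assume t: "t \<in> I"
      then obtain y where y: "selection f (x t) y"
        and x': "(x has_vector_derivative - (laplacian A *v y)) (at t within I)"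
        using elim(1) unfolding consensus_inclusion_def by blast
      have "((\<lambda>t. primitive (f i) (x t $ i)) has_real_derivative y $ i * (- (laplacian A *v y)) $ i) (at t within I)" for i
        using has_real_derivative_vec_nth[OF x', of i] elim(2)[rule_format, OF UNIV_I t] y
        by (intro primitive_chain_rule mono) blast+
      then have "((\<lambda>t. energy w f (x t)) has_real_derivative
          (\<Sum>i\<in>UNIV. w i * (y $ i * (- (laplacian A *v y)) $ i))) (at t within I)"
        unfolding energy_def by (intro DERIV_sum DERIV_cmult)
      moreover have "(\<Sum>i\<in>UNIV. w i * (y $ i * (- (laplacian A *v y)) $ i)) = - disagreement A w y"
        unfolding weighted_laplacian_form[OF w, symmetric] by (simp add: sum_negf)
      ultimately show "\<exists>y. selection f (x t) y \<and>
          (x has_vector_derivative - (laplacian A *v y)) (at t within I) \<and>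
          ((\<lambda>t. energy w f (x t)) has_real_derivative - disagreement A w y) (at t within I)"
        using y x' by auto
    qed
  qed
qed

lemma absolutely_continuous_energy:
  fixes x :: "real \<Rightarrow> real ^ 'n"
  assumes mono: "\<And>i. mono (f i)" and AC: "absolutely_continuous_on_interval a b x"
  shows "absolutely_continuous_on_interval a b (\<lambda>t. energy w f (x t))"
proof -
  have "compact (x ` {a..b})"
    by (intro compact_continuous_image absolutely_continuous_on_interval_imp_continuous_on AC) auto
  then have "bounded (x ` {a..b})" by (rule compact_imp_bounded)
  then obtain R where "\<forall>z\<in>x ` {a..b}. norm z \<le> R" unfolding bounded_iff by (elim exE)
  then have R: "norm (x t) \<le> R" if "t \<in> {a..b}" for t using that by simp
  then have Ri: "\<bar>x t $ i\<bar> \<le> R" if "t \<in> {a..b}" for t i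
    using component_le_norm_cart[of "x t" i] that by (meson order_trans)
  define K where "K = (\<Sum>i\<in>UNIV. \<bar>w i\<bar> * (\<bar>f i R\<bar> + \<bar>f i (- R)\<bar>))"
  show ?thesis
  proof (rule absolutely_continuous_on_interval_lipschitz_image[OF AC, of _ K])
    fix s t assume st: "s \<in> {a..b}" "t \<in> {a..b}"
    have "\<bar>w i * primitive (f i) (x t $ i) - w i * primitive (f i) (x s $ i)\<bar>
        \<le> \<bar>w i\<bar> * (\<bar>f i R\<bar> + \<bar>f i (- R)\<bar>) * norm (x t - x s)" for i
    proof -
      have "\<bar>w i * primitive (f i) (x t $ i) - w i * primitive (f i) (x s $ i)\<bar>
          = \<bar>w i\<bar> * \<bar>primitive (f i) (x t $ i) - primitive (f i) (x s $ i)\<bar>"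
        by (simp add: abs_mult right_diff_distrib[symmetric])
      also have "\<dots> \<le> \<bar>w i\<bar> * ((\<bar>f i R\<bar> + \<bar>f i (- R)\<bar>) * \<bar>x t $ i - x s $ i\<bar>)"
        using Ri st by (intro mult_left_mono primitive_lipschitz mono) auto
      also have "\<dots> \<le> \<bar>w i\<bar> * ((\<bar>f i R\<bar> + \<bar>f i (- R)\<bar>) * norm (x t - x s))"
        using component_le_norm_cart[of "x t - x s" i] by (intro mult_left_mono) auto
      finally show ?thesis by (simp add: mult.assoc)
    qed
    then have "(\<Sum>i\<in>UNIV. \<bar>w i * primitive (f i) (x t $ i) - w i * primitive (f i) (x s $ i)\<bar>) \<le> K * norm (x t - x s)"
      unfolding K_def sum_distrib_right by (intro sum_mono)
    then show "norm (energy w f (x t) - energy w f (x s)) \<le> K * norm (x t - x s)"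
      unfolding energy_def sum_subtractf[symmetric] real_norm_def by (rule order_trans[OF sum_abs])
  qed
qed

text \<open>The rate \<open>c\<close> is required for all selections at \<open>x t\<close>, since nothing is known about which of them
  the solution follows. With \<open>c = 0\<close> this is monotonicity of the energy.\<close>

lemma energy_decrease:
  fixes A :: "real ^ 'n ^ 'n" and x :: "real \<Rightarrow> real ^ 'n"
  assumes mono: "\<And>i. mono (f i)" and w: "left_null_weights A w"
    and sol: "solution_on (consensus_inclusion A f) I x" and ab: "a \<le> b" "{a..b} \<subseteq> I"
    and rate: "\<And>t y. \<lbrakk>t \<in> {a..b}; selection f (x t) y\<rbrakk> \<Longrightarrow> c \<le> disagreement A w y"
  shows "energy w f (x b) \<le> energy w f (x a) - c * (b - a)"
proof -
  have "absolutely_continuous_on_interval a b x"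
    using sol ab by (simp add: solution_on_def locally_absolutely_continuous_on_def)
  then have AC: "absolutely_continuous_on_interval a b (\<lambda>t. energy w f (x t))"
    by (intro absolutely_continuous_energy mono)
  have "AE t in lebesgue. t \<in> {a..b} \<longrightarrow>
      (\<exists>d\<le>-c. ((\<lambda>t. energy w f (x t)) has_real_derivative d) (at t within {a..b}))"
    using energy_derivative_along_solution[OF mono w sol]
  proof eventually_elim
    case (elim t)
    show ?case
    proof
      assume t: "t \<in> {a..b}"
      then obtain y where y: "selection f (x t) y"
        and d: "((\<lambda>t. energy w f (x t)) has_real_derivative - disagreement A w y) (at t within I)"
        using elim ab by blast
      then show "\<exists>d\<le>-c. ((\<lambda>t. energy w f (x t)) has_real_derivative d) (at t within {a..b})"
        using rate[OF t y] DERIV_subset[OF d ab(2)] by (intro exI[of _ "- disagreement A w y"]) auto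
    qed
  qed
  from increment_le_of_AE_derivative_le[OF ab(1) AC this] show ?thesis by simp
qed

text \<open>Growth of every primitive makes sublevel sets of the energy bounded and the energy bounded below.\<close>

lemma energy_coercive:
  fixes f :: "'n::finite \<Rightarrow> real \<Rightarrow> real"
  assumes mono: "\<And>i. mono (f i)" and signs: "\<And>i. \<exists>s. f i s < 0" "\<And>i. \<exists>s. f i s > 0"
    and w: "\<And>i. w i > 0"
  obtains c C where "c > 0" "\<And>z. c * norm z - C \<le> energy w f z"
proof -
  have "\<exists>c C. c > 0 \<and> (\<forall>s. c * \<bar>s\<bar> - C \<le> primitive (f i) s)" for i
    using signs[of i] primitive_coercive[OF mono[of i]] by metis
  then obtain c C where c: "\<And>i. c i > 0" and C: "\<And>i s. c i * \<bar>s\<bar> - C i \<le> primitive (f i) s"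
    by metis
  define c0 where "c0 = Min (range (\<lambda>i. w i * c i))"
  have c0: "c0 > 0" "c0 \<le> w i * c i" for i
    using c w by (auto simp: c0_def)
  show thesis
  proof (rule that[OF c0(1)])
    fix z :: "real ^ 'n"
    have "c0 * norm z \<le> c0 * (\<Sum>i\<in>UNIV. \<bar>z $ i\<bar>)"
      using c0 norm_le_l1_cart[of z] by (intro mult_left_mono) auto
    also have "\<dots> \<le> (\<Sum>i\<in>UNIV. w i * c i * \<bar>z $ i\<bar>)"
      unfolding sum_distrib_left using c0 by (intro sum_mono mult_right_mono) auto
    finally have "c0 * norm z - (\<Sum>i\<in>UNIV. w i * C i) \<le> (\<Sum>i\<in>UNIV. w i * (c i * \<bar>z $ i\<bar> - C i))"
      by (simp add: right_diff_distrib sum_subtractf mult.assoc)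
    also have "\<dots> \<le> energy w f z"
      unfolding energy_def using C less_imp_le[OF w] by (intro sum_mono mult_left_mono) auto
    finally show "c0 * norm z - (\<Sum>i\<in>UNIV. w i * C i) \<le> energy w f z" .
  qed
qed

lemma selection_bounded:
  fixes f :: "'n::finite \<Rightarrow> real \<Rightarrow> real"
  assumes mono: "\<And>i. mono (f i)"
  obtains B where "\<And>z y. \<lbrakk>norm z \<le> R; selection f z y\<rbrakk> \<Longrightarrow> norm y \<le> B"
proof (rule that)
  fix z y :: "real ^ 'n" assume z: "norm z \<le> R" and y: "selection f z y"
  have "\<bar>y $ i\<bar> \<le> \<bar>f i (- R - 1)\<bar> + \<bar>f i (R + 1)\<bar>" for i
  proof -
    have "\<bar>z $ i\<bar> \<le> R" using component_le_norm_cart[of z i] z by linarith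
    then have "- R - 1 < z $ i" "z $ i < R + 1" by auto
    then have "f i (- R - 1) \<le> y $ i" "y $ i \<le> f i (R + 1)"
      using y filippov_mono[OF mono, of i] by blast+
    then show ?thesis by linarith
  qed
  then have "(\<Sum>i\<in>UNIV. \<bar>y $ i\<bar>) \<le> (\<Sum>i\<in>UNIV. \<bar>f i (- R - 1)\<bar> + \<bar>f i (R + 1)\<bar>)"
    by (intro sum_mono)
  then show "norm y \<le> (\<Sum>i\<in>UNIV. \<bar>f i (- R - 1)\<bar> + \<bar>f i (R + 1)\<bar>)"
    using norm_le_l1_cart[of y] by linarith
qed

text \<open>On a bounded set the selections, hence the velocities, are bounded; the increment bound is then
  applied to every component and to its negative.\<close>

lemma bounded_solution_lipschitz:
  fixes A :: "real ^ 'n ^ 'n" and x :: "real \<Rightarrow> real ^ 'n"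
  assumes mono: "\<And>i. mono (f i)"
    and sol: "solution_on (consensus_inclusion A f) I x"
    and bounded: "\<And>t. t \<in> I \<Longrightarrow> norm (x t) \<le> R"
  obtains K where "K > 0" "\<And>a b. \<lbrakk>a \<le> b; {a..b} \<subseteq> I\<rbrakk> \<Longrightarrow> norm (x b - x a) \<le> K * (b - a)"
proof -
  obtain B where B: "\<And>z y. \<lbrakk>norm z \<le> R; selection f z y\<rbrakk> \<Longrightarrow> norm y \<le> B"
    by (rule selection_bounded[where f = f and R = R, OF mono]) (rule that; blast)
  obtain l where l: "l > 0" "\<And>y. norm (laplacian A *v y) \<le> norm y * l"
    using bounded_linear.pos_bounded[OF matrix_vector_mul_bounded_linear[of "laplacian A"]] by auto
  define M where "M = (\<bar>B\<bar> + 1) * l"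
  have M: "M > 0" using l by (simp add: M_def add_nonneg_pos)
  have speed: "AE t in lebesgue. t \<in> I \<longrightarrow> (\<exists>v. norm v \<le> M \<and> (x has_vector_derivative v) (at t within I))"
  proof -
    have "AE t in lebesgue. t \<in> I \<longrightarrow>
        (\<exists>v\<in>consensus_inclusion A f (x t). (x has_vector_derivative v) (at t within I))"
      using sol by (simp add: solution_on_def)
    then show ?thesis
    proof eventually_elim
      case (elim t)
      show ?case
      proof
        assume t: "t \<in> I"
        then obtain y where y: "selection f (x t) y"
          and x': "(x has_vector_derivative - (laplacian A *v y)) (at t within I)"
          using elim unfolding consensus_inclusion_def by blast
        have "norm y \<le> \<bar>B\<bar> + 1" using B[OF bounded[OF t] y] by linarith
        then have "norm y * l \<le> M" unfolding M_def using l by (intro mult_right_mono) auto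
        then have "norm (- (laplacian A *v y)) \<le> M" using l(2)[of y] by simp
        then show "\<exists>v. norm v \<le> M \<and> (x has_vector_derivative v) (at t within I)" using x' by blast
      qed
    qed
  qed
  show thesis
  proof (rule that[of "M * CARD('n)"])
    show "M * CARD('n) > 0" using M by simp
    fix a b assume ab: "a \<le> b" "{a..b} \<subseteq> I"
    have AC: "absolutely_continuous_on_interval a b x"
      using sol ab by (simp add: solution_on_def locally_absolutely_continuous_on_def)
    \<comment> \<open>The sign \<open>\<sigma>\<close> handles both directions of the absolute value at once.\<close>
    have "\<sigma> * x b $ i - \<sigma> * x a $ i \<le> M * (b - a)" if \<sigma>: "\<bar>\<sigma>\<bar> = 1" for i and \<sigma> :: real
    proof (rule increment_le_of_AE_derivative_le[OF ab(1)])
      show "absolutely_continuous_on_interval a b (\<lambda>t. \<sigma> * x t $ i)"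
      proof (rule absolutely_continuous_on_interval_lipschitz_image[OF AC, of _ 1])
        fix s t
        have "norm (\<sigma> * x t $ i - \<sigma> * x s $ i) = \<bar>(x t - x s) $ i\<bar>"
          using \<sigma> by (simp add: right_diff_distrib[symmetric] abs_mult)
        then show "norm (\<sigma> * x t $ i - \<sigma> * x s $ i) \<le> 1 * norm (x t - x s)"
          using component_le_norm_cart[of "x t - x s" i] by simp
      qed
      show "AE t in lebesgue. t \<in> {a..b} \<longrightarrow>
          (\<exists>d\<le>M. ((\<lambda>t. \<sigma> * x t $ i) has_real_derivative d) (at t within {a..b}))"
        using speed
      proof eventually_elim
        case (elim t)
        show ?case
        proof
          assume "t \<in> {a..b}"
          then obtain v where v: "norm v \<le> M" "(x has_vector_derivative v) (at t within I)"
            using elim ab by blast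
          have "\<sigma> * v $ i \<le> \<bar>v $ i\<bar>" using \<sigma> abs_ge_self[of "\<sigma> * v $ i"] by (simp add: abs_mult)
          then have "\<sigma> * v $ i \<le> M" using component_le_norm_cart[of v i] v(1) by linarith
          moreover have "((\<lambda>t. \<sigma> * x t $ i) has_real_derivative \<sigma> * v $ i) (at t within {a..b})"
            by (intro DERIV_cmult DERIV_subset[OF has_real_derivative_vec_nth[OF v(2)] ab(2)])
          ultimately show "\<exists>d\<le>M. ((\<lambda>t. \<sigma> * x t $ i) has_real_derivative d) (at t within {a..b})"
            by blast
        qed
      qed
    qed
    from this[of 1] this[of "-1"] have "\<bar>(x b - x a) $ i\<bar> \<le> M * (b - a)" for i
      by (simp add: abs_le_iff)
    then have "(\<Sum>i\<in>UNIV. \<bar>(x b - x a) $ i\<bar>) \<le> (\<Sum>i\<in>(UNIV::'n set). M * (b - a))" by (intro sum_mono)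
    then show "norm (x b - x a) \<le> M * CARD('n) * (b - a)"
      using norm_le_l1_cart[of "x b - x a"] by (simp add: mult_ac)
  qed
qed

section \<open>Convergence to the agreement set\<close>

text \<open>The defining inequalities of the Filippov intervals, written as disjunctions of closed conditions
  on the pair of state and selection.\<close>

lemma selection_closed_graph:
  fixes f :: "'n::finite \<Rightarrow> real \<Rightarrow> real"
  assumes mono: "\<And>i. mono (f i)"
  shows "closed {p :: (real ^ 'n) \<times> (real ^ 'n). selection f (fst p) (snd p)}"
proof -
  have "{p :: (real ^ 'n) \<times> (real ^ 'n). selection f (fst p) (snd p)} =
     (\<Inter>i. \<Inter>u. {p. fst p $ i \<le> u} \<union> {p. f i u \<le> snd p $ i}) \<inter>
     (\<Inter>i. \<Inter>v. {p. v \<le> fst p $ i} \<union> {p. snd p $ i \<le> f i v})"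
    by (simp add: set_eq_iff filippov_mono[OF mono] imp_conv_disj linorder_not_less) blast
  moreover have "closed \<dots>"
    by (intro closed_Int closed_INT ballI closed_Un closed_Collect_le continuous_intros)
  ultimately show ?thesis by simp
qed

text \<open>The admissible pairs of state and selection form a compact set, on which the continuous disagreement
  form attains its minimum. The minimum is positive: a selection with zero disagreement is constant,
  and its common value certifies membership in the agreement set.\<close>

lemma disagreement_bounded_below_off_agreement_set:
  fixes f :: "'n::finite \<Rightarrow> real \<Rightarrow> real"
  assumes mono: "\<And>i. mono (f i)"
    and G: "weighted_digraph E A" "strongly_connected E" and w: "\<And>i. w i > 0" and "\<epsilon> > 0"
  obtains c where "c > 0"
    "\<And>z y. \<lbrakk>norm z \<le> R; infdist z (agreement_set f) \<ge> \<epsilon>; selection f z y\<rbrakk> \<Longrightarrow> c \<le> disagreement A w y"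
proof -
  \<comment> \<open>First components are states, second components selections.\<close>
  define P where "P = {p :: (real ^ 'n) \<times> (real ^ 'n).
    norm (fst p) \<le> R \<and> infdist (fst p) (agreement_set f) \<ge> \<epsilon> \<and> selection f (fst p) (snd p)}"
  obtain B where B: "\<And>z y. \<lbrakk>norm z \<le> R; selection f z y\<rbrakk> \<Longrightarrow> norm y \<le> B"
    by (rule selection_bounded[where f = f and R = R, OF mono]) (rule that; blast)
  have "closed P"
    unfolding P_def
    by (intro closed_Collect_conj selection_closed_graph mono closed_Collect_le continuous_intros)
  moreover have "P \<subseteq> cball 0 R \<times> cball 0 B"
    using B by (auto simp: P_def)
  then have "bounded P"
    by (rule bounded_subset[rotated]) (intro bounded_Times bounded_cball)
  ultimately have "compact P" by (simp add: compact_eq_bounded_closed)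
  have pos: "disagreement A w (snd p) > 0" if p: "p \<in> P" for p
  proof (rule ccontr)
    assume "\<not> ?thesis"
    then have "disagreement A w (snd p) = 0"
      using disagreement_nonneg[of E A w "snd p", OF G(1) w] by linarith
    then have eq: "snd p $ i = snd p $ j" for i j
      by (rule disagreement_eq_0_imp_equal[where w = w, OF G w])
    have "snd p $ undefined \<in> filippov (f i) (fst p $ i)" for i
      using p unfolding P_def eq[of undefined i] by simp
    then have "fst p \<in> agreement_set f" unfolding agreement_set_def by blast
    then show False using p \<open>\<epsilon> > 0\<close> by (simp add: P_def)
  qed
  show thesis
  proof (cases "P = {}")
    case True
    then show thesis by (intro that[of 1]) (auto simp: P_def)
  next
    case False
    have "continuous_on P (\<lambda>p. disagreement A w (snd p))" by (intro continuous_intros)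
    then obtain p where "p \<in> P" "\<And>q. q \<in> P \<Longrightarrow> disagreement A w (snd p) \<le> disagreement A w (snd q)"
      using continuous_attains_inf[OF \<open>compact P\<close> False] by blast
    then show thesis using pos by (intro that[of "disagreement A w (snd p)"]) (auto simp: P_def)
  qed
qed

text \<open>Barbalat's argument. Each visit of \<open>x\<close> to distance \<open>\<epsilon>\<close> from \<open>D\<close> keeps it at distance at least \<open>\<epsilon>/2\<close>
  for a fixed time, since \<open>x\<close> is Lipschitz, and so costs a fixed amount of \<open>V\<close>. As \<open>V\<close> is bounded
  below, such visits cannot recur at arbitrarily late times.\<close>

lemma infdist_tendsto_0_of_dissipation:
  fixes x :: "real \<Rightarrow> 'a::real_normed_vector" and V :: "real \<Rightarrow> real"
  assumes "K > 0"
    and lip: "\<And>a b. \<lbrakk>0 \<le> a; a \<le> b\<rbrakk> \<Longrightarrow> norm (x b - x a) \<le> K * (b - a)"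
    and decr: "\<And>a b. \<lbrakk>0 \<le> a; a \<le> b\<rbrakk> \<Longrightarrow> V b \<le> V a"
    and below: "\<And>t. t \<ge> 0 \<Longrightarrow> m \<le> V t"
    and diss: "\<And>\<epsilon>. \<epsilon> > 0 \<Longrightarrow> \<exists>c>0. \<forall>a b. 0 \<le> a \<longrightarrow> a \<le> b \<longrightarrow>
      (\<forall>t\<in>{a..b}. \<epsilon> \<le> infdist (x t) D) \<longrightarrow> V b \<le> V a - c * (b - a)"
  shows "((\<lambda>t. infdist (x t) D) \<longlongrightarrow> 0) at_top"
proof (rule ccontr)
  assume "\<not> ?thesis"
  then obtain \<epsilon> where "\<epsilon> > 0" and "\<not> eventually (\<lambda>t. dist (infdist (x t) D) 0 < \<epsilon>) at_top"
    unfolding tendsto_iff by blast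
  then have far: "\<exists>t\<ge>T. \<epsilon> \<le> infdist (x t) D" for T
    unfolding eventually_at_top_linorder by (force simp: infdist_nonneg not_less)
  \<comment> \<open>The time needed, at speed at most \<open>K\<close>, to come closer to \<open>D\<close> by \<open>\<epsilon>/2\<close>.\<close>
  define \<eta> where "\<eta> = \<epsilon> / (2 * K)"
  have \<eta>: "\<eta> > 0" "K * \<eta> = \<epsilon> / 2" using \<open>\<epsilon> > 0\<close> \<open>K > 0\<close> by (auto simp: \<eta>_def)
  obtain c where c: "c > 0" and drop: "\<And>a b. \<lbrakk>0 \<le> a; a \<le> b; \<forall>t\<in>{a..b}. \<epsilon> / 2 \<le> infdist (x t) D\<rbrakk>
      \<Longrightarrow> V b \<le> V a - c * (b - a)"
    using diss[of "\<epsilon> / 2"] \<open>\<epsilon> > 0\<close> by auto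
  have step: "\<exists>t'\<ge>0. V t' \<le> V T - c * \<eta>" if "T \<ge> 0" for T
  proof -
    obtain t where t: "t \<ge> T" "\<epsilon> \<le> infdist (x t) D" using far by blast
    have "\<epsilon> / 2 \<le> infdist (x s) D" if s: "s \<in> {t..t + \<eta>}" for s
    proof -
      have "dist (x t) (x s) \<le> K * (s - t)"
        using lip[of t s] s t \<open>T \<ge> 0\<close> by (simp add: dist_norm norm_minus_commute)
      also have "\<dots> \<le> K * \<eta>" using s \<open>K > 0\<close> by (intro mult_left_mono) auto
      finally show ?thesis using infdist_triangle[of "x t" D "x s"] t \<eta>(2) by linarith
    qed
    then have "V (t + \<eta>) \<le> V t - c * \<eta>"
      using drop[of t "t + \<eta>"] t \<open>T \<ge> 0\<close> \<eta> by simp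
    moreover have "V t \<le> V T" using decr t \<open>T \<ge> 0\<close> by simp
    ultimately show ?thesis using t \<open>T \<ge> 0\<close> \<eta> by (intro exI[of _ "t + \<eta>"]) auto
  qed
  have "\<exists>t\<ge>0. V t \<le> V 0 - real n * (c * \<eta>)" for n
  proof (induction n)
    case (Suc n)
    then obtain t where "t \<ge> 0" "V t \<le> V 0 - real n * (c * \<eta>)" by blast
    with step[of t] show ?case by (fastforce simp: algebra_simps)
  qed auto
  moreover obtain n where n: "real n * (c * \<eta>) > V 0 - m"
    using reals_Archimedean3[of "c * \<eta>"] c \<eta> by auto
  ultimately obtain t where "t \<ge> 0" "V t \<le> V 0 - real n * (c * \<eta>)" by blast
  with below[of t] n show False by linarith
qed

lemma sign_changes_of_limits:
  assumes "\<exists>l::ereal. ((\<lambda>s. ereal (f s)) \<longlongrightarrow> l) at_top \<and> l > 0"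
    and "\<exists>l::ereal. ((\<lambda>s. ereal (f s)) \<longlongrightarrow> l) at_bot \<and> l < 0"
  shows "\<exists>s::real. f s > 0" "\<exists>s. f s < 0"
proof -
  obtain k l :: ereal where k: "((\<lambda>s. ereal (f s)) \<longlongrightarrow> k) at_top" "0 < k"
    and l: "((\<lambda>s. ereal (f s)) \<longlongrightarrow> l) at_bot" "l < 0"
    using assms by (elim exE conjE)
  have "eventually (\<lambda>s. 0 < ereal (f s)) at_top" by (rule order_tendstoD(1)[OF k])
  then have "\<exists>s. 0 < ereal (f s)" by (rule eventually_happens'[rotated]) simp
  then show "\<exists>s::real. f s > 0" by simp
  have "eventually (\<lambda>s. ereal (f s) < 0) at_bot" by (rule order_tendstoD(2)[OF l])
  then have "\<exists>s. ereal (f s) < 0" by (rule eventually_happens'[rotated]) simp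
  then show "\<exists>s. f s < 0" by simp
qed

lemma agreement_set_nonempty:
  fixes f :: "'n::finite \<Rightarrow> real \<Rightarrow> real"
  assumes "\<And>i. mono (f i)" "\<And>i. \<exists>s. f i s < 0" "\<And>i. \<exists>s. f i s > 0"
  shows "agreement_set f \<noteq> {}"
proof -
  have "\<exists>p. 0 \<in> filippov (f i) p" for i
  proof -
    obtain a b where "f i a < 0" "f i b > 0" using assms(2,3) by blast
    then show ?thesis by (rule zero_in_filippov_mono[OF assms(1)]) blast
  qed
  then obtain p where "\<And>i. 0 \<in> filippov (f i) (p i)" by metis
  then have "(\<chi> i. p i) \<in> agreement_set f" by (auto simp: agreement_set_def)
  then show ?thesis by blast
qed

theorem theorem3p3:
  fixes E :: "('n::finite \<times> 'n) set"
    and A :: "real ^ 'n ^ 'n"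
    and f :: "'n \<Rightarrow> real \<Rightarrow> real"
  assumes "weighted_digraph E A"
    and "strongly_connected E \<or> (undirected A \<and> connected_graph E)"
    and "\<And>i. mono (f i)"
    and "\<And>i. \<exists>l::ereal. ((\<lambda>s. ereal (f i s)) \<longlongrightarrow> l) at_top \<and> l > 0"
    and "\<And>i. \<exists>l::ereal. ((\<lambda>s. ereal (f i s)) \<longlongrightarrow> l) at_bot \<and> l < 0"
    and "\<And>x0. \<exists>x. complete_solution (consensus_inclusion A f) x \<and> x 0 = x0"
  shows "\<forall>x. complete_solution (consensus_inclusion A f) x \<longrightarrow>
              converges_to_set x (agreement_set f)"
proof (intro allI impI)
  fix x assume "complete_solution (consensus_inclusion A f) x"
  then have sol: "solution_on (consensus_inclusion A f) {0..} x" by (simp add: complete_solution_def)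
  have G: "weighted_digraph E A" and mono: "\<And>i. mono (f i)" by (fact assms)+
  have sc: "strongly_connected E"
    using assms(2) undirected_connected_imp_strongly_connected[OF G] by blast
  have signs: "\<And>i. \<exists>s. f i s < 0" "\<And>i. \<exists>s. f i s > 0"
    using sign_changes_of_limits[OF assms(4,5)] by blast+
  obtain w where w: "left_null_weights A w" "\<And>i. w i > 0"
    by (rule positive_left_null_weights[OF G sc]) (erule that; blast)
  obtain c C where c: "c > 0" and C: "\<And>z. c * norm z - C \<le> energy w f z"
    by (rule energy_coercive[where f = f and w = w, OF mono signs w(2)]) (erule that; blast)
  have decr: "energy w f (x b) \<le> energy w f (x a)" if "0 \<le> a" "a \<le> b" for a b
    using energy_decrease[where f = f, OF mono w(1) sol that(2), of 0] disagreement_nonneg[where w = w, OF G w(2)] that by auto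
  have bounded: "norm (x t) \<le> (energy w f (x 0) + C) / c" if "t \<in> {0..}" for t
    using C[of "x t"] decr[of 0 t] that c by (simp add: field_simps)
  obtain K where K: "K > 0" "\<And>a b. \<lbrakk>a \<le> b; {a..b} \<subseteq> {0..}\<rbrakk> \<Longrightarrow> norm (x b - x a) \<le> K * (b - a)"
    by (rule bounded_solution_lipschitz[where f = f, OF mono sol bounded]) (assumption, erule that, blast)
  have "((\<lambda>t. infdist (x t) (agreement_set f)) \<longlongrightarrow> 0) at_top"
  proof (rule infdist_tendsto_0_of_dissipation[OF K(1), where V = "\<lambda>t. energy w f (x t)" and m = "- C"])
    show "norm (x b - x a) \<le> K * (b - a)" if "0 \<le> a" "a \<le> b" for a b
      using K(2)[of a b] that by auto
    show "- C \<le> energy w f (x t)" for t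
    proof -
      have "0 \<le> c * norm (x t)" using c by simp
      then show ?thesis using C[of "x t"] by linarith
    qed
    fix \<epsilon> :: real assume "\<epsilon> > 0"
    then obtain r where r: "r > 0" "\<And>z y. \<lbrakk>norm z \<le> (energy w f (x 0) + C) / c;
        infdist z (agreement_set f) \<ge> \<epsilon>; selection f z y\<rbrakk> \<Longrightarrow> r \<le> disagreement A w y"
      by (rule disagreement_bounded_below_off_agreement_set[where f = f and w = w, OF mono G sc w(2)]) (erule that; blast)
    have "energy w f (x b) \<le> energy w f (x a) - r * (b - a)"
      if "0 \<le> a" "a \<le> b" "\<forall>t\<in>{a..b}. \<epsilon> \<le> infdist (x t) (agreement_set f)" for a b
    proof (rule energy_decrease[where f = f, OF mono w(1) sol that(2)])
      show "{a..b} \<subseteq> {0..}" using that(1) by auto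
      show "r \<le> disagreement A w y" if "t \<in> {a..b}" "selection f (x t) y" for t y
        using that \<open>0 \<le> a\<close> \<open>\<forall>t\<in>{a..b}. _\<close> bounded[of t] by (intro r(2)[of "x t"]) auto
    qed
    then show "\<exists>r>0. \<forall>a b. 0 \<le> a \<longrightarrow> a \<le> b \<longrightarrow>
        (\<forall>t\<in>{a..b}. \<epsilon> \<le> infdist (x t) (agreement_set f)) \<longrightarrow>
        energy w f (x b) \<le> energy w f (x a) - r * (b - a)"
      using r(1) by blast
  qed (rule decr)
  then show "converges_to_set x (agreement_set f)"
    using agreement_set_nonempty[OF mono signs] by (simp add: converges_to_set_def)
qed

end
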